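(* Let $p\ge 2$ and suppose that $(l,r)$ and $(\tilde{l},\tilde{r})$ are $p$-admissible constraint pairs. Given $S\in S_G^p(0,T)$, let $(A^l,A^r)$ (resp. $(\tilde{A}^l,\tilde{A}^r)$) be the pair of constraining processes for the reflected problem with constraints $l,r$ (resp. $\tilde{l},\tilde{r}$) for $S$. If $r\geq \tilde{r}$ and $l\leq \tilde{l}$, then for any $t\in[0,T]$, $$A^l_t\leq \tilde{A}^l_t,\qquad A^r_t\leq \tilde{A}^r_t,\quad \text{q.s.}$$
   Context: Fix $T>0$. $\Omega_T=C_0([0,T];\mathbb{R})$ is the space of real continuous functions on $[0,T]$ vanishing at $0$, with the supremum norm; $B$ is the canonical process. Fix $0\le\underline{\sigma}^2<\bar{\sigma}^2$ and set $G(a)=\frac12(\bar{\sigma}^2a^+-\underline{\sigma}^2a^-)$. $C_{l,Lip}(\mathbb{R}^n)$ is the set of functions $\varphi$ with $|\varphi(x)-\varphi(y)|\le C(1+|x|^k+|y|^k)|x-y|$ for some $C,k$; $C_{b,Lip}(\mathbb{R}^n)$ is the set of bounded Lipschitz functions. $L_{ip}(\Omega_t)=\{\varphi(B_{t_1},\dots,B_{t_n}): n\in\mathbb{N},\ t_1,\dots,t_n\in[0,t],\ \varphi\in C_{l,Lip}(\mathbb{R}^n)\}$. $\hat{\mathbb{E}}:L_{ip}(\Omega_T)\to\mathbb{R}$ is the $G$-expectation, i.e. the sublinear expectation under which $B$ is a $G$-Brownian motion: for $0\le s\le t\le T$ and $\varphi\in C_{l,Lip}(\mathbb{R})$, $\hat{\mathbb{E}}[\varphi(x+B_t-B_s)]=u(t-s,x)$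 where $u$ is the viscosity solution of $\partial_tu-G(\partial_x^2u)=0$, $u(0,\cdot)=\varphi$, and for $0\le t_1\le\dots\le t_n\le T$, $\varphi\in C_{l,Lip}(\mathbb{R}^n)$, $\hat{\mathbb{E}}[\varphi(B_{t_1},\dots,B_{t_{n-1}},B_{t_n}-B_{t_{n-1}})]=\hat{\mathbb{E}}[\psi(B_{t_1},\dots,B_{t_{n-1}})]$ with $\psi(x_1,\dots,x_{n-1})=\hat{\mathbb{E}}[\varphi(x_1,\dots,x_{n-1},B_{t_n}-B_{t_{n-1}})]$. For $p\ge1$, $L_G^p(\Omega_T)$ is the completion of $L_{ip}(\Omega_T)$ under $(\hat{\mathbb{E}}[|\xi|^p])^{1/p}$, to which $\hat{\mathbb E}$ extends. There is a weakly compact set $\mathcal{P}$ of probability measures on $(\Omega_T,\mathcal{B}(\Omega_T))$ (fixed) with $\hat{\mathbb{E}}[\xi]=\sup_{P\in\mathcal{P}}E_P[\xi]$ for $\xi\in L_G^1(\Omega_T)$. A Borel set $A$ is polar if $\sup_{P\in\mathcal{P}}P(A)=0$; a property holds quasi-surely (q.s.) if it holds outside a polar set; random variables equal q.s. are identified. $S_G^0(0,T)=\{h(t,B_{t_1\wedge t},\dots,B_{t_n\wedge t}): t_1,\dots,t_n\in[0,T],\ h\in C_{b,Lip}(\mathbb{R}^{n+1})\}$; $S_G^p(0,T)$ is its completion under $\|\eta\|_{S_G^p}=(\hat{\mathbb{E}}[\sup_{t\in[0,T]}|\eta_t|^p])^{1/p}$. $M_I(0,T)$ (resp. $M_{BV}(0,T)$)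 is the collection of processes whose paths on $[0,T]$ are, outside a polar set, continuous and increasing (resp. continuous and of bounded variation). Integrals with respect to such processes are pathwise Stieltjes integrals outside a polar set. $p$-admissible constraint pair ($p\ge2$): functions $r,l:[0,T]\times\Omega_T\times\mathbb{R}\to\mathbb{R}$ ($\omega$ suppressed) such that (i) for each fixed $x\in\mathbb{R}$, $r(\cdot,x),l(\cdot,x)$ are continuous on $[0,T]$, q.s.; (ii) for any fixed $t\in[0,T]$, $r(t,\cdot)$, $l(t,\cdot)$ are strictly increasing, and $r(t,x)>l(t,x)$ for any $(t,x)\in[0,T]\times\mathbb{R}$, q.s.; (iii) for any $t\in[0,T]$ the inverses $r^{-1}(t,0)$ and $l^{-1}(t,0)$ (the points at which $r(t,\cdot)$, respectively $l(t,\cdot)$, vanish) exist, q.s., the processes $\{r^{-1}(t,0)\}_{t\in[0,T]}$, $\{l^{-1}(t,0)\}_{t\in[0,T]}$ belong to $S_G^p(0,T)$, and $\inf_{(t,\omega)\in[0,T]\times\Omega_T}(l^{-1}(t,\omega,0)-r^{-1}(t,\omega,0))>0$. Reflected problem with constraints $l,r$ for $S\in S_G^p(0,T)$: its solution is the unique pair $(X,A)\in S_G^p(0,T)\times(M_{BV}(0,T)\cap S_G^p(0,T))$ with $X_t=S_t+A_t$, $l(t,X_t)\le0\le r(t,X_t)$ for $t\in[0,T]$, q.s., $A_{0-}=0$, and $A=A^r-A^l$ with $A^r,A^l\in M_I(0,T)\cap S_G^p(0,T)$, $\int_0^Tl(s,X_s)dA^l_s=\int_0^Tr(s,X_s)dA^r_s=0$,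 q.s. The processes $(A^l,A^r)$ are called the constraining processes. Conventions: $A_{0-}=A^r_{0-}=A^l_{0-}=0$, and the integrals over $[0,T]$ include the possible atoms at time $0$ of sizes $A^r_0,A^l_0$. *)

theory Defs
  imports "HOL-Probability.Probability"
begin

section \<open>Path space\<close>

text \<open>
  A path in \<open>C\<^sub>0([0,T];\<real>)\<close> is represented by its extension to \<open>\<real>\<close> that is constant on
  \<open>(-\<infinity>,0]\<close> and on \<open>[T,\<infinity>)\<close>.  This is an isometry for the supremum norms, so the topology and
  the Borel sets are those inherited from the Banach space of bounded continuous functions.
\<close>

type_synonym path = "real \<Rightarrow>\<^sub>C real"
type_synonym process = "real \<Rightarrow> path \<Rightarrow> real"

definition Omega :: "real \<Rightarrow> path set" where
  "Omega T = {\<omega>. apply_bcontfun \<omega> 0 = 0 \<and>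
     (\<forall>t\<le>0. apply_bcontfun \<omega> t = apply_bcontfun \<omega> 0) \<and>
     (\<forall>t\<ge>T. apply_bcontfun \<omega> t = apply_bcontfun \<omega> T)}"

abbreviation B :: process where
  "B t \<omega> \<equiv> apply_bcontfun \<omega> t"

definition path_space :: "real \<Rightarrow> path measure" where
  "path_space T = restrict_space borel (Omega T)"

section \<open>Cylinder random variables and the $G$-expectation\<close>

text \<open>Functions on \<open>\<real>\<^sup>n\<close> are functions on lists, constrained only on lists of length \<open>n\<close>.\<close>

definition lnorm :: "real list \<Rightarrow> real" where
  "lnorm xs = L2_set (\<lambda>i. xs ! i) {..<length xs}"

definition ldist :: "real list \<Rightarrow> real list \<Rightarrow> real" where
  "ldist xs ys = L2_set (\<lambda>i. xs ! i - ys ! i) {..<length xs}"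

definition C_lLip :: "nat \<Rightarrow> (real list \<Rightarrow> real) set" where
  "C_lLip n = {\<phi>. \<exists>C. \<exists>k::nat. \<forall>xs ys. length xs = n \<longrightarrow> length ys = n \<longrightarrow>
     \<bar>\<phi> xs - \<phi> ys\<bar> \<le> C * (1 + lnorm xs ^ k + lnorm ys ^ k) * ldist xs ys}"

definition C_bLip :: "nat \<Rightarrow> (real list \<Rightarrow> real) set" where
  "C_bLip n = {\<phi>. (\<exists>M. \<forall>xs. length xs = n \<longrightarrow> \<bar>\<phi> xs\<bar> \<le> M) \<and>
     (\<exists>C. \<forall>xs ys. length xs = n \<longrightarrow> length ys = n \<longrightarrow> \<bar>\<phi> xs - \<phi> ys\<bar> \<le> C * ldist xs ys)}"

text \<open>Random variables are functions on the whole type of which only the values on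
  \<open>Omega T\<close> matter.\<close>

definition L_ip :: "real \<Rightarrow> real \<Rightarrow> (path \<Rightarrow> real) set" where
  "L_ip T t = {\<xi>. \<exists>ts \<phi>. set ts \<subseteq> {0..t} \<and> \<phi> \<in> C_lLip (length ts) \<and>
     (\<forall>\<omega>\<in>Omega T. \<xi> \<omega> = \<phi> (map (\<lambda>s. B s \<omega>) ts))}"

text \<open>\<open>sl\<close> and \<open>su\<close> are the lower and upper volatilities.\<close>

definition G_fun :: "real \<Rightarrow> real \<Rightarrow> real \<Rightarrow> real" where
  "G_fun sl su a = (su\<^sup>2 * max a 0 - sl\<^sup>2 * max (- a) 0) / 2"

definition test_function ::
    "(real \<Rightarrow> real \<Rightarrow> real) \<Rightarrow> (real \<Rightarrow> real \<Rightarrow> real) \<Rightarrow> (real \<Rightarrow> real \<Rightarrow> real) \<Rightarrow>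
     (real \<Rightarrow> real \<Rightarrow> real) \<Rightarrow> bool" where
  "test_function \<psi> \<psi>t \<psi>x \<psi>xx \<longleftrightarrow>
     (\<forall>t>0. \<forall>x.
        ((\<lambda>s. \<psi> s x) has_real_derivative \<psi>t t x) (at t) \<and>
        ((\<lambda>y. \<psi> t y) has_real_derivative \<psi>x t x) (at x) \<and>
        ((\<lambda>y. \<psi>x t y) has_real_derivative \<psi>xx t x) (at x)) \<and>
     (\<forall>f\<in>{\<psi>, \<psi>t, \<psi>x, \<psi>xx}. continuous_on ({0<..} \<times> UNIV) (\<lambda>(t, x). f t x))"

definition viscosity_subsolution ::
    "real \<Rightarrow> real \<Rightarrow> (real \<Rightarrow> real \<Rightarrow> real) \<Rightarrow> bool" where
  "viscosity_subsolution sl su u \<longleftrightarrow>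
     (\<forall>\<psi> \<psi>t \<psi>x \<psi>xx t x. test_function \<psi> \<psi>t \<psi>x \<psi>xx \<longrightarrow> 0 < t \<longrightarrow>
        (\<forall>\<^sub>F (s, y) in nhds (t, x). u s y - \<psi> s y \<le> u t x - \<psi> t x) \<longrightarrow>
        \<psi>t t x - G_fun sl su (\<psi>xx t x) \<le> 0)"

definition viscosity_supersolution ::
    "real \<Rightarrow> real \<Rightarrow> (real \<Rightarrow> real \<Rightarrow> real) \<Rightarrow> bool" where
  "viscosity_supersolution sl su u \<longleftrightarrow>
     (\<forall>\<psi> \<psi>t \<psi>x \<psi>xx t x. test_function \<psi> \<psi>t \<psi>x \<psi>xx \<longrightarrow> 0 < t \<longrightarrow>
        (\<forall>\<^sub>F (s, y) in nhds (t, x). u s y - \<psi> s y \<ge> u t x - \<psi> t x) \<longrightarrow>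
        \<psi>t t x - G_fun sl su (\<psi>xx t x) \<ge> 0)"

text \<open>The viscosity solution of the $G$-heat equation is unique in the class of continuous
  functions of polynomial growth in \<open>x\<close>, locally uniformly in \<open>t\<close>.\<close>

definition G_heat_solution ::
    "real \<Rightarrow> real \<Rightarrow> (real \<Rightarrow> real) \<Rightarrow> (real \<Rightarrow> real \<Rightarrow> real) \<Rightarrow> bool" where
  "G_heat_solution sl su \<phi> u \<longleftrightarrow>
     continuous_on ({0..} \<times> UNIV) (\<lambda>(t, x). u t x) \<and>
     (\<forall>b. \<exists>C. \<exists>k::nat. \<forall>t\<in>{0..b}. \<forall>x. \<bar>u t x\<bar> \<le> C * (1 + \<bar>x\<bar> ^ k)) \<and>
     (\<forall>x. u 0 x = \<phi> x) \<and>
     viscosity_subsolution sl su u \<and> viscosity_supersolution sl su u"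

definition sublinear_expectation :: "real \<Rightarrow> ((path \<Rightarrow> real) \<Rightarrow> real) \<Rightarrow> bool" where
  "sublinear_expectation T E \<longleftrightarrow>
     (\<forall>\<xi>\<in>L_ip T T. \<forall>\<eta>\<in>L_ip T T. (\<forall>\<omega>\<in>Omega T. \<xi> \<omega> \<le> \<eta> \<omega>) \<longrightarrow> E \<xi> \<le> E \<eta>) \<and>
     (\<forall>c. E (\<lambda>_. c) = c) \<and>
     (\<forall>\<xi>\<in>L_ip T T. \<forall>\<eta>\<in>L_ip T T. E (\<lambda>\<omega>. \<xi> \<omega> + \<eta> \<omega>) \<le> E \<xi> + E \<eta>) \<and>
     (\<forall>\<xi>\<in>L_ip T T. \<forall>c\<ge>0. E (\<lambda>\<omega>. c * \<xi> \<omega>) = c * E \<xi>)"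

definition G_expectation :: "real \<Rightarrow> real \<Rightarrow> real \<Rightarrow> ((path \<Rightarrow> real) \<Rightarrow> real) \<Rightarrow> bool" where
  "G_expectation T sl su E \<longleftrightarrow>
     sublinear_expectation T E \<and>
     (\<forall>\<phi>\<in>C_lLip 1. \<exists>u. G_heat_solution sl su (\<lambda>x. \<phi> [x]) u \<and>
        (\<forall>s t x. 0 \<le> s \<longrightarrow> s \<le> t \<longrightarrow> t \<le> T \<longrightarrow>
           E (\<lambda>\<omega>. \<phi> [x + B t \<omega> - B s \<omega>]) = u (t - s) x)) \<and>
     (\<forall>ts t \<phi>. ts \<noteq> [] \<longrightarrow> sorted (ts @ [t]) \<longrightarrow> set (ts @ [t]) \<subseteq> {0..T} \<longrightarrow>
        \<phi> \<in> C_lLip (length ts + 1) \<longrightarrow>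
        E (\<lambda>\<omega>. \<phi> (map (\<lambda>s. B s \<omega>) ts @ [B t \<omega> - B (last ts) \<omega>])) =
        E (\<lambda>\<omega>. (\<lambda>xs. E (\<lambda>\<omega>'. \<phi> (xs @ [B t \<omega>' - B (last ts) \<omega>'])))
                   (map (\<lambda>s. B s \<omega>) ts)))"

section \<open>The representing family of measures\<close>

definition path_probs :: "real \<Rightarrow> path measure set" where
  "path_probs T = {P. prob_space P \<and> sets P = sets (path_space T)}"

definition weak_topology :: "real \<Rightarrow> path measure topology" where
  "weak_topology T = topology_generated_by
     {{P \<in> path_probs T. (\<integral>\<omega>. f \<omega> \<partial>P) \<in> U} | (f :: path \<Rightarrow> real) U.
        continuous_on (Omega T) f \<and> bounded (f ` Omega T) \<and> open U}"

text \<open>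
  The upper expectation of an arbitrary \<open>[0,\<infinity>]\<close>-valued function.  On Borel functions it is
  \<open>sup\<^sub>P E\<^sub>P\<close>; the infimum over Borel majorants serves functions that are Borel measurable only
  outside a polar set.
\<close>

definition upper_expectation ::
    "real \<Rightarrow> path measure set \<Rightarrow> (path \<Rightarrow> ennreal) \<Rightarrow> ennreal" where
  "upper_expectation T \<P> \<xi> =
     (INF g \<in> {g \<in> borel_measurable (path_space T). \<forall>\<omega>\<in>Omega T. \<xi> \<omega> \<le> g \<omega>}.
        SUP P\<in>\<P>. \<integral>\<^sup>+\<omega>. g \<omega> \<partial>P)"

text \<open>
  The completions \<open>L\<^sub>G\<^sup>p\<close> and (below) \<open>S\<^sub>G\<^sup>p\<close> are realised as spaces of functions: the
  elements are the limits of sequences from the dense subspace.  Convergence in norm is stated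
  for the \<open>p\<close>-th power of the norm.
\<close>

definition L_G :: "real \<Rightarrow> path measure set \<Rightarrow> real \<Rightarrow> (path \<Rightarrow> real) set" where
  "L_G T \<P> p = {\<xi> \<in> borel_measurable (path_space T). \<exists>X. (\<forall>n. X n \<in> L_ip T T) \<and>
     (\<lambda>n. upper_expectation T \<P> (\<lambda>\<omega>. ennreal (\<bar>X n \<omega> - \<xi> \<omega>\<bar> powr p))) \<longlonglongrightarrow> 0}"

definition represents ::
    "real \<Rightarrow> path measure set \<Rightarrow> ((path \<Rightarrow> real) \<Rightarrow> real) \<Rightarrow> bool" where
  "represents T \<P> E \<longleftrightarrow> compactin (weak_topology T) \<P> \<and>
     (\<forall>\<xi>\<in>L_G T \<P> 1. (\<forall>P\<in>\<P>. integrable P \<xi>) \<and>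
        bdd_above ((\<lambda>P. \<integral>\<omega>. \<xi> \<omega> \<partial>P) ` \<P>) \<and>
        E \<xi> = (SUP P\<in>\<P>. \<integral>\<omega>. \<xi> \<omega> \<partial>P))"

definition polar :: "real \<Rightarrow> path measure set \<Rightarrow> path set \<Rightarrow> bool" where
  "polar T \<P> N \<longleftrightarrow> N \<in> sets (path_space T) \<and> (SUP P\<in>\<P>. emeasure P N) = 0"

definition quasi_surely ::
    "real \<Rightarrow> path measure set \<Rightarrow> (path \<Rightarrow> bool) \<Rightarrow> bool" where
  "quasi_surely T \<P> Q \<longleftrightarrow> (\<exists>N. polar T \<P> N \<and> (\<forall>\<omega>\<in>Omega T - N. Q \<omega>))"

section \<open>Spaces of processes\<close>

definition S_G0 :: "real \<Rightarrow> process set" where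
  "S_G0 T = {\<eta>. \<exists>ts h. set ts \<subseteq> {0..T} \<and> h \<in> C_bLip (length ts + 1) \<and>
     (\<forall>t\<in>{0..T}. \<forall>\<omega>\<in>Omega T. \<eta> t \<omega> = h (t # map (\<lambda>s. B (min s t) \<omega>) ts))}"

definition S_G :: "real \<Rightarrow> path measure set \<Rightarrow> real \<Rightarrow> process set" where
  "S_G T \<P> p = {\<eta>. \<exists>H. (\<forall>n. H n \<in> S_G0 T) \<and>
     (\<lambda>n. upper_expectation T \<P>
        (\<lambda>\<omega>. SUP t\<in>{0..T}. ennreal (\<bar>H n t \<omega> - \<eta> t \<omega>\<bar> powr p))) \<longlonglongrightarrow> 0}"

definition bounded_variation :: "real \<Rightarrow> real \<Rightarrow> (real \<Rightarrow> real) \<Rightarrow> bool" where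
  "bounded_variation a b f \<longleftrightarrow> (\<exists>V. \<forall>ts. sorted ts \<longrightarrow> set ts \<subseteq> {a..b} \<longrightarrow>
     (\<Sum>i<length ts - 1. \<bar>f (ts ! Suc i) - f (ts ! i)\<bar>) \<le> V)"

definition M_I :: "real \<Rightarrow> path measure set \<Rightarrow> process set" where
  "M_I T \<P> = {\<eta>. quasi_surely T \<P> (\<lambda>\<omega>.
     continuous_on {0..T} (\<lambda>t. \<eta> t \<omega>) \<and> mono_on {0..T} (\<lambda>t. \<eta> t \<omega>))}"

definition M_BV :: "real \<Rightarrow> path measure set \<Rightarrow> process set" where
  "M_BV T \<P> = {\<eta>. quasi_surely T \<P> (\<lambda>\<omega>.
     continuous_on {0..T} (\<lambda>t. \<eta> t \<omega>) \<and> bounded_variation 0 T (\<lambda>t. \<eta> t \<omega>))}"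

section \<open>The reflected problem\<close>

type_synonym constraint = "real \<Rightarrow> path \<Rightarrow> real \<Rightarrow> real"

definition inverse_at_0 :: "constraint \<Rightarrow> process" where
  "inverse_at_0 f t \<omega> = (THE x. f t \<omega> x = 0)"

text \<open>
  In clauses about all times (and all \<open>x\<close>) the exceptional polar set is common to all times,
  as the pathwise integrals and the inverse processes require; for the continuity in time it
  may depend on \<open>x\<close>.  The infimum in the last clause is taken outside a polar set, since the
  inverses are defined only there.
\<close>

definition admissible ::
    "real \<Rightarrow> path measure set \<Rightarrow> real \<Rightarrow> constraint \<Rightarrow> constraint \<Rightarrow> bool" where
  "admissible T \<P> p l r \<longleftrightarrow>
     (\<forall>x. quasi_surely T \<P> (\<lambda>\<omega>. continuous_on {0..T} (\<lambda>t. r t \<omega> x) \<and>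
                                continuous_on {0..T} (\<lambda>t. l t \<omega> x))) \<and>
     quasi_surely T \<P> (\<lambda>\<omega>. \<forall>t\<in>{0..T}. strict_mono (r t \<omega>) \<and> strict_mono (l t \<omega>) \<and>
                                (\<forall>x. l t \<omega> x < r t \<omega> x)) \<and>
     quasi_surely T \<P> (\<lambda>\<omega>. \<forall>t\<in>{0..T}. (\<exists>x. r t \<omega> x = 0) \<and> (\<exists>x. l t \<omega> x = 0)) \<and>
     inverse_at_0 r \<in> S_G T \<P> p \<and> inverse_at_0 l \<in> S_G T \<P> p \<and>
     (\<exists>\<delta>>0. quasi_surely T \<P> (\<lambda>\<omega>. \<forall>t\<in>{0..T}.
        \<delta> \<le> inverse_at_0 l t \<omega> - inverse_at_0 r t \<omega>))"

text \<open>
  The Stieltjes measure on \<open>[0,T]\<close> of an increasing path \<open>a\<close> with \<open>a\<^sub>0\<^sub>- = 0\<close>: extending \<open>a\<close> by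
  \<open>0\<close> to the left of \<open>0\<close> produces the atom of size \<open>a 0\<close> at time \<open>0\<close>.
\<close>

definition stieltjes_measure :: "real \<Rightarrow> (real \<Rightarrow> real) \<Rightarrow> real measure" where
  "stieltjes_measure T a =
     interval_measure (\<lambda>s. if s < 0 then 0 else if s \<le> T then a s else a T)"

definition stieltjes_integral_zero ::
    "real \<Rightarrow> (real \<Rightarrow> real) \<Rightarrow> (real \<Rightarrow> real) \<Rightarrow> bool" where
  "stieltjes_integral_zero T f a \<longleftrightarrow>
     set_integrable (stieltjes_measure T a) {0..T} f \<and>
     (LINT s:{0..T}|stieltjes_measure T a. f s) = 0"

text \<open>
  With the convention \<open>a\<^sub>0\<^sub>- = 0\<close>, an increasing path is also required not to jump down at
  time \<open>0\<close>; hence the conditions \<open>0 \<le> Al 0 \<omega>\<close> and \<open>0 \<le> Ar 0 \<omega>\<close>.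
\<close>

definition reflected_solution ::
    "real \<Rightarrow> path measure set \<Rightarrow> real \<Rightarrow> constraint \<Rightarrow> constraint \<Rightarrow> process \<Rightarrow>
     process \<Rightarrow> process \<Rightarrow> process \<Rightarrow> process \<Rightarrow> bool" where
  "reflected_solution T \<P> p l r S X A Al Ar \<longleftrightarrow>
     X \<in> S_G T \<P> p \<and> A \<in> M_BV T \<P> \<inter> S_G T \<P> p \<and>
     Ar \<in> M_I T \<P> \<inter> S_G T \<P> p \<and> Al \<in> M_I T \<P> \<inter> S_G T \<P> p \<and>
     quasi_surely T \<P> (\<lambda>\<omega>. \<forall>t\<in>{0..T}. X t \<omega> = S t \<omega> + A t \<omega>) \<and>
     quasi_surely T \<P> (\<lambda>\<omega>. \<forall>t\<in>{0..T}. l t \<omega> (X t \<omega>) \<le> 0 \<and> 0 \<le> r t \<omega> (X t \<omega>)) \<and>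
     quasi_surely T \<P> (\<lambda>\<omega>. \<forall>t\<in>{0..T}. A t \<omega> = Ar t \<omega> - Al t \<omega>) \<and>
     quasi_surely T \<P> (\<lambda>\<omega>. 0 \<le> Ar 0 \<omega> \<and> 0 \<le> Al 0 \<omega>) \<and>
     quasi_surely T \<P> (\<lambda>\<omega>.
       stieltjes_integral_zero T (\<lambda>s. l s \<omega> (X s \<omega>)) (\<lambda>s. Al s \<omega>) \<and>
       stieltjes_integral_zero T (\<lambda>s. r s \<omega> (X s \<omega>)) (\<lambda>s. Ar s \<omega>))"

definition constraining_processes ::
    "real \<Rightarrow> path measure set \<Rightarrow> real \<Rightarrow> constraint \<Rightarrow> constraint \<Rightarrow> process \<Rightarrow>
     process \<Rightarrow> process \<Rightarrow> bool" where
  "constraining_processes T \<P> p l r S Al Ar \<longleftrightarrow>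
     (\<exists>X A. reflected_solution T \<P> p l r S X A Al Ar)"

end

theory Submission
  imports Defs
begin

text \<open>
  The statement is pathwise: outside a polar set, the reflected problem says that the path
  \<open>x = S + A\<^sup>r - A\<^sup>l\<close> stays between the two continuous barriers
  \<open>R\<^sub>t = r\<^sup>-\<^sup>1(t,0) < L\<^sub>t = l\<^sup>-\<^sup>1(t,0)\<close>, that \<open>A\<^sup>l\<close> grows only while \<open>x\<close> touches \<open>L\<close>, and that
  \<open>A\<^sup>r\<close> grows only while \<open>x\<close> touches \<open>R\<close>.  The hypotheses \<open>r \<ge> r'\<close> and \<open>l \<le> l'\<close> mean that the
  first pair of barriers encloses the second one: \<open>R \<le> R'\<close> and \<open>L' \<le> L\<close>.

  For such deterministic paths the order \<open>A\<^sup>l \<le> A'\<^sup>l\<close>, \<open>A\<^sup>r \<le> A'\<^sup>r\<close> is shown to hold at time 0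
  (\<open>al_le_start\<close>) and to survive a little longer whenever it holds at a time \<open>u\<close>
  (\<open>al_le_after\<close>); the infimum of the times of failure then cannot exist
  (\<open>reflected_path_comparison\<close>).  The order for \<open>A\<^sup>l\<close> could break at \<open>u\<close> only if \<open>x\<close> is at \<open>L\<close>
  and \<open>A\<^sup>l = A'\<^sup>l\<close>.  Then \<open>x - x' = A\<^sup>r - A'\<^sup>r \<le> 0\<close> while \<open>x' \<le> L' \<le> L = x\<close>, so the two paths
  meet at \<open>L = L'\<close>, away from both lower barriers.  Hence \<open>A\<^sup>r\<close> and \<open>A'\<^sup>r\<close> are constant and equal
  for a while, and as long as \<open>A\<^sup>l > A'\<^sup>l\<close> the path \<open>x\<close> is strictly below \<open>x' \<le> L' \<le> L\<close>, which
  prevents \<open>A\<^sup>l\<close> from growing.  The assertion for \<open>A\<^sup>r\<close> follows by the reflection \<open>x \<mapsto> -x\<close>.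

  To reach this situation one needs that quasi-surely \<open>S\<close> is continuous
  (\<open>S_G_continuous_paths\<close>, a Borel--Cantelli argument for the upper expectation), that the
  barriers are continuous (\<open>continuous_on_zero\<close>), and that a vanishing Stieltjes integral of a
  function of constant sign forces the integrator to be constant on every interval where the
  integrand does not vanish (\<open>stieltjes_integral_zero_flat\<close>).
\<close>

section \<open>Comparison of deterministic reflected paths\<close>

text \<open>
  Complementarity is expressed on intervals instead of by Stieltjes integrals.  The intervals in
  \<open>flat\<close> are open on the left, so that \<open>al\<close> cannot grow right after a last time of contact either,
  and \<open>start\<close> accounts for the atom at time 0.
\<close>

locale reflected_path =
  fixes T :: real and L R s al ar :: "real \<Rightarrow> real"
  assumes continuous: "continuous_on {0..T} L" "continuous_on {0..T} R"
      "continuous_on {0..T} s" "continuous_on {0..T} al" "continuous_on {0..T} ar"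
    and separated: "t \<in> {0..T} \<Longrightarrow> R t < L t"
    and mono: "mono_on {0..T} al" "mono_on {0..T} ar"
    and nonneg: "0 \<le> al 0" "0 \<le> ar 0"
    and between: "t \<in> {0..T} \<Longrightarrow> R t \<le> s t + ar t - al t"
      "t \<in> {0..T} \<Longrightarrow> s t + ar t - al t \<le> L t"
    and start: "s 0 + ar 0 - al 0 < L 0 \<Longrightarrow> al 0 = 0"
      "R 0 < s 0 + ar 0 - al 0 \<Longrightarrow> ar 0 = 0"
    and flat: "\<lbrakk>0 \<le> u; u \<le> v; v \<le> T; \<And>t. u < t \<Longrightarrow> t \<le> v \<Longrightarrow> s t + ar t - al t < L t\<rbrakk>
        \<Longrightarrow> al u = al v"
      "\<lbrakk>0 \<le> u; u \<le> v; v \<le> T; \<And>t. u < t \<Longrightarrow> t \<le> v \<Longrightarrow> R t < s t + ar t - al t\<rbrakk>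
        \<Longrightarrow> ar u = ar v"
begin

text \<open>Turning the picture upside down exchanges the two barriers and the two reflection terms.\<close>

lemma mirror: "reflected_path T (\<lambda>t. - R t) (\<lambda>t. - L t) (\<lambda>t. - s t) ar al"
proof (unfold_locales, goal_cases)
  case (15 u v) show ?case by (rule flat(2)) (use 15 in \<open>fastforce+\<close>)
next
  case (16 u v) show ?case by (rule flat(1)) (use 16 in \<open>fastforce+\<close>)
qed (use continuous separated mono nonneg between start in
      \<open>force intro!: continuous_intros simp: algebra_simps\<close>)+

lemma continuous_reflection: "continuous_on {0..T} (\<lambda>t. s t + ar t - al t)"
  by (intro continuous_intros continuous)

end

lemma less_near:
  fixes f g :: "real \<Rightarrow> real"
  assumes "continuous_on S f" "continuous_on S g" "u \<in> S" "f u < g u"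
  obtains d where "0 < d" "\<And>t. t \<in> S \<Longrightarrow> \<bar>t - u\<bar> < d \<Longrightarrow> f t < g t"
proof -
  have "continuous_on S (\<lambda>t. g t - f t)" by (intro continuous_intros assms)
  with assms obtain d where d: "0 < d"
    "\<And>t. t \<in> S \<Longrightarrow> dist t u < d \<Longrightarrow> dist (g t - f t) (g u - f u) < g u - f u"
    unfolding continuous_on_iff by (metis diff_gt_0_iff_gt)
  show ?thesis
    by (rule that[OF d(1)]) (use d(2) in \<open>fastforce simp: dist_real_def abs_less_iff\<close>)
qed

text \<open>
  An initial push down of the outer path puts it at \<open>L 0\<close>, hence off \<open>R 0\<close>, so it receives no
  initial push up; the inner path has to be brought from the same point at least as far down.
\<close>

lemma al_le_start:
  assumes "reflected_path T L R s al ar" and "reflected_path T L' R' s al' ar'"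
    and "0 \<le> T" and "L' 0 \<le> L 0"
  shows "al 0 \<le> al' 0"
proof (rule ccontr)
  interpret a: reflected_path T L R s al ar by fact
  interpret b: reflected_path T L' R' s al' ar' by fact
  assume less: "\<not> al 0 \<le> al' 0"
  have "s 0 + ar 0 - al 0 = L 0"
    using less b.nonneg a.start(1) a.between(2)[of 0] \<open>0 \<le> T\<close> by force
  moreover from this have "ar 0 = 0"
    using a.start(2) a.separated[of 0] \<open>0 \<le> T\<close> by force
  ultimately show False
    using less b.nonneg b.between(2)[of 0] \<open>L' 0 \<le> L 0\<close> \<open>0 \<le> T\<close> by force
qed

text \<open>
  The order of both pairs of reflection terms at \<open>u\<close> is needed to conclude for the one pair: it
  is what forces the two paths to meet when \<open>al\<close> and \<open>al'\<close> agree at a time of contact with \<open>L\<close>.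
\<close>

lemma al_le_after:
  assumes "reflected_path T L R s al ar" and "reflected_path T L' R' s al' ar'"
    and wider: "\<And>t. t \<in> {0..T} \<Longrightarrow> L' t \<le> L t"
    and u: "u \<in> {0..T}" and le: "al u \<le> al' u" "ar u \<le> ar' u"
  shows "\<exists>d>0. \<forall>t. u \<le> t \<and> t < u + d \<and> t \<le> T \<longrightarrow> al t \<le> al' t"
proof -
  have near: ?thesis
    if "0 < d" "\<And>t. u \<le> t \<Longrightarrow> t < u + d \<Longrightarrow> t \<le> T \<Longrightarrow> al t \<le> al' t" for d
    using that by (intro exI[of _ d]) simp
  interpret a: reflected_path T L R s al ar by fact
  interpret b: reflected_path T L' R' s al' ar' by fact
  let ?x = "\<lambda>t. s t + ar t - al t" and ?x' = "\<lambda>t. s t + ar' t - al' t"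
  consider (off) "?x u < L u" | (ahead) "al u < al' u"
    | (contact) "?x u = L u" "al u = al' u"
    using a.between(2)[OF u] le by fastforce
  then show ?thesis
  proof cases
    case off
    obtain d where d: "0 < d" "\<And>t. t \<in> {0..T} \<Longrightarrow> \<bar>t - u\<bar> < d \<Longrightarrow> ?x t < L t"
      using less_near[OF a.continuous_reflection a.continuous(1) u off] by blast
    show ?thesis
    proof (rule near[OF d(1)])
      fix t assume t: "u \<le> t" "t < u + d" "t \<le> T"
      have "al u = al t" by (rule a.flat(1)) (use t u d(2) in auto)
      also have "al' u \<le> al' t" using mono_onD[OF b.mono(1)] u t by auto
      ultimately show "al t \<le> al' t" using le by linarith
    qed
  next
    case ahead
    from less_near[OF a.continuous(4) b.continuous(4) u this] obtain d
      where d: "0 < d" "\<And>t. t \<in> {0..T} \<Longrightarrow> \<bar>t - u\<bar> < d \<Longrightarrow> al t < al' t" by blast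
    show ?thesis by (rule near[OF d(1)], rule less_imp_le, rule d(2)) (use u in simp_all)
  next
    case contact
    have ar: "ar u = ar' u" and x': "?x' u = L' u" and L: "L' u = L u"
      using contact le wider[OF u] b.between(2)[OF u] by linarith+
    have off: "R u < ?x u" "R' u < ?x' u"
      using contact(1) x' a.separated[OF u] b.separated[OF u] by linarith+
    obtain d where d: "0 < d" "\<And>t. t \<in> {0..T} \<Longrightarrow> \<bar>t - u\<bar> < d \<Longrightarrow> R t < ?x t"
      using less_near[OF a.continuous(2) a.continuous_reflection u off(1)] by blast
    obtain d' where d': "0 < d'" "\<And>t. t \<in> {0..T} \<Longrightarrow> \<bar>t - u\<bar> < d' \<Longrightarrow> R' t < ?x' t"
      using less_near[OF b.continuous(2) b.continuous_reflection u off(2)] by blast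
    have ar_eq: "ar t = ar' t" if t: "u \<le> t" "t < u + min d d'" "t \<le> T" for t
    proof -
      have "ar u = ar t" by (rule a.flat(2)) (use t u d(2) in auto)
      moreover have "ar' u = ar' t" by (rule b.flat(2)) (use t u d'(2) in auto)
      ultimately show ?thesis using ar by simp
    qed
    show ?thesis
    proof (rule near)
      show "0 < min d d'" using d(1) d'(1) by simp
      fix t assume t: "u \<le> t" "t < u + min d d'" "t \<le> T"
      show "al t \<le> al' t"
      proof (rule ccontr)
        assume neg: "\<not> al t \<le> al' t"
        define Z where "Z = {q \<in> {u..t}. al q \<le> al' q}"
        have sub: "{u..t} \<subseteq> {0..T}" using u t by simp
        have "closed Z"
          unfolding Z_def
          by (intro continuous_on_closed_Collect_le
                continuous_on_subset[OF a.continuous(4) sub]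
                continuous_on_subset[OF b.continuous(4) sub] closed_atLeastAtMost)
        moreover have "bounded Z"
          by (rule bounded_subset[OF bounded_closed_interval[of u t]]) (auto simp: Z_def)
        ultimately have "compact Z" by (simp add: compact_eq_bounded_closed)
        moreover have "u \<in> Z" using t le by (simp add: Z_def)
        \<comment> \<open>\<open>v\<close> is the last time before \<open>t\<close> at which the order holds.\<close>
        ultimately obtain v where v: "v \<in> Z" and last: "\<And>q. q \<in> Z \<Longrightarrow> q \<le> v"
          using compact_attains_sup[of Z] by blast
        have uv: "u \<le> v" "v \<le> t" "al v \<le> al' v" using v by (simp_all add: Z_def)
        have "al v = al t"
        proof (rule a.flat(1))
          show "0 \<le> v" "v \<le> t" "t \<le> T" using uv u t by simp_all
          fix q assume q: "v < q" "q \<le> t"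
          then have "q \<notin> Z" using last by force
          then have "al' q < al q" using q uv by (simp add: Z_def)
          moreover have "ar q = ar' q" by (rule ar_eq) (use q uv t in linarith)+
          moreover have "q \<in> {0..T}" using q uv u t by simp
          ultimately show "?x q < L q" using b.between(2)[of q] wider[of q] by linarith
        qed
        moreover have "al' v \<le> al' t" by (rule mono_onD[OF b.mono(1)]) (use uv u t in simp_all)
        ultimately show False using uv neg by linarith
      qed
    qed
  qed
qed

theorem reflected_path_comparison:
  assumes a: "reflected_path T L R s al ar" and b: "reflected_path T L' R' s al' ar'"
    and wider: "\<And>t. t \<in> {0..T} \<Longrightarrow> R t \<le> R' t" "\<And>t. t \<in> {0..T} \<Longrightarrow> L' t \<le> L t"
    and t: "t \<in> {0..T}"
  shows "al t \<le> al' t \<and> ar t \<le> ar' t"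
proof (rule ccontr)
  interpret a: reflected_path T L R s al ar by fact
  interpret b: reflected_path T L' R' s al' ar' by fact
  define Bad where "Bad = {t \<in> {0..T}. al' t < al t \<or> ar' t < ar t}"
  define u where "u = Inf Bad"
  assume "\<not> ?thesis"
  then have "t \<in> Bad" using t by (auto simp: Bad_def)
  have bdd: "bdd_below Bad" by (auto simp: Bad_def bdd_below_def)
  have u_le: "u \<le> q" if "q \<in> Bad" for q
    unfolding u_def using that bdd by (rule cInf_lower)
  have "0 \<le> u"
    unfolding u_def by (rule cInf_greatest) (use \<open>t \<in> Bad\<close> in \<open>auto simp: Bad_def\<close>)
  then have u: "u \<in> {0..T}" using u_le[OF \<open>t \<in> Bad\<close>] t by simp
  \<comment> \<open>Failure is an open condition and excluded at time 0, so it cannot begin at \<open>u\<close> itself.\<close>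
  have notbad: "u \<notin> Bad"
  proof
    assume bad: "u \<in> Bad"
    have "0 \<le> T" "0 \<in> {0..T}" using t by auto
    have "al 0 \<le> al' 0" using al_le_start[OF a b] wider \<open>0 \<in> {0..T}\<close> \<open>0 \<le> T\<close> by blast
    moreover have "ar 0 \<le> ar' 0"
      using al_le_start[OF a.mirror b.mirror] wider \<open>0 \<in> {0..T}\<close> \<open>0 \<le> T\<close> neg_le_iff_le by blast
    ultimately have "u \<noteq> 0" using bad unfolding Bad_def by fastforce
    obtain d where d: "d > 0" "\<And>q. q \<in> {0..T} \<Longrightarrow> \<bar>q - u\<bar> < d \<Longrightarrow> q \<in> Bad"
    proof (cases "al' u < al u")
      case True
      then obtain d where "0 < d" "\<And>q. q \<in> {0..T} \<Longrightarrow> \<bar>q - u\<bar> < d \<Longrightarrow> al' q < al q"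
        using less_near[OF b.continuous(4) a.continuous(4) u] by blast
      then show ?thesis by (intro that[of d]) (simp_all add: Bad_def)
    next
      case False
      then have "ar' u < ar u" using bad by (simp add: Bad_def)
      then obtain d where "0 < d" "\<And>q. q \<in> {0..T} \<Longrightarrow> \<bar>q - u\<bar> < d \<Longrightarrow> ar' q < ar q"
        using less_near[OF b.continuous(5) a.continuous(5) u] by blast
      then show ?thesis by (intro that[of d]) (simp_all add: Bad_def)
    qed
    have "max 0 (u - d / 2) \<in> Bad" by (rule d(2)) (use d(1) u in \<open>auto simp: max_def\<close>)
    from u_le[OF this] show False using \<open>0 \<le> u\<close> \<open>u \<noteq> 0\<close> d(1) by (simp add: max_def split: if_splits)
  qed
  then have le: "al u \<le> al' u" "ar u \<le> ar' u" using u by (auto simp: Bad_def)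
  obtain d where d: "0 < d" "\<And>t. u \<le> t \<Longrightarrow> t < u + d \<Longrightarrow> t \<le> T \<Longrightarrow> al t \<le> al' t"
    using al_le_after[OF a b wider(2) u le] by auto
  obtain d' where d': "0 < d'" "\<And>t. u \<le> t \<Longrightarrow> t < u + d' \<Longrightarrow> t \<le> T \<Longrightarrow> ar t \<le> ar' t"
    using al_le_after[OF a.mirror b.mirror _ u le(2,1)] wider(1) by auto
  have "u + min d d' \<le> q" if "q \<in> Bad" for q
  proof (rule ccontr)
    assume "\<not> u + min d d' \<le> q"
    then have "al q \<le> al' q" "ar q \<le> ar' q"
      using d(2)[of q] d'(2)[of q] u_le[OF that] that by (auto simp: Bad_def)
    then show False using that by (auto simp: Bad_def)
  qed
  then have "u + min d d' \<le> Inf Bad" using \<open>t \<in> Bad\<close> by (intro cInf_greatest) auto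
  then have "u + min d d' \<le> u" by (simp add: u_def)
  then show False using d(1) d'(1) by auto
qed

section \<open>Vanishing Stieltjes integrals\<close>

text \<open>
  As the integrand has constant sign, it vanishes almost everywhere for the Stieltjes measure;
  an interval where it does not vanish is therefore a null set, and its measure is the increment
  of \<open>a\<close>.  At time 0 the same applies to the atom of size \<open>a 0\<close>.
\<close>

lemma stieltjes_integral_zero_flat:
  assumes zero: "stieltjes_integral_zero T f a"
    and sign: "(\<forall>t\<in>{0..T}. 0 \<le> f t) \<or> (\<forall>t\<in>{0..T}. f t \<le> 0)"
    and cont: "continuous_on {0..T} a" and mono: "mono_on {0..T} a" and "0 \<le> a 0"
    and "0 \<le> T"
  shows "f 0 \<noteq> 0 \<Longrightarrow> a 0 = 0"
    and "\<lbrakk>0 \<le> u; u \<le> v; v \<le> T; \<And>t. u < t \<Longrightarrow> t \<le> v \<Longrightarrow> f t \<noteq> 0\<rbrakk> \<Longrightarrow> a u = a v"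
proof -
  define F where "F = (\<lambda>s. if s < 0 then 0 else if s \<le> T then a s else a T)"
  have a_mono: "a u \<le> a v" if "0 \<le> u" "u \<le> v" "v \<le> T" for u v
    using mono_onD[OF mono] that by auto
  have F_mono: "F u \<le> F v" if "u \<le> v" for u v
    using that \<open>0 \<le> a 0\<close> a_mono[of 0 v] a_mono[of 0 T] a_mono[of u v] a_mono[of u T] \<open>0 \<le> T\<close>
    by (auto simp: F_def)
  have F_right: "continuous (at_right c) F" for c
  proof (cases "c < 0")
    case True
    have "\<forall>\<^sub>F x in at_right c. x < 0"
      using eventually_at_right_real[OF True] by eventually_elim auto
    then have "\<forall>\<^sub>F x in at_right c. F x = F c"
      by eventually_elim (use True in \<open>auto simp: F_def\<close>)
    then show ?thesis unfolding continuous_within by (rule tendsto_eventually)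
  next
    case False
    have "continuous_on {0..} (\<lambda>t. a (min t T))"
      by (rule continuous_on_compose2[OF cont]) (use \<open>0 \<le> T\<close> in \<open>auto intro!: continuous_intros\<close>)
    then have "continuous (at c within {c..}) (\<lambda>t. a (min t T))"
      using False by (auto simp: continuous_on_eq_continuous_within intro!: continuous_within_subset[of c "{0..}" _ "{c..}"])
    then have "continuous (at c within {c<..}) (\<lambda>t. a (min t T))"
      by (rule continuous_within_subset) auto
    then show ?thesis
      unfolding continuous_within
      by (rule Lim_transform_eventually[THEN tendsto_eq_rhs])
         (use False in \<open>auto simp: F_def min_def eventually_at_filter\<close>)
  qed
  let ?M = "interval_measure F"
  have M: "stieltjes_measure T a = ?M" by (simp add: stieltjes_measure_def F_def)
  have int: "integrable ?M (\<lambda>s. indicator {0..T} s * f s)"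
    and int0: "(LINT s|?M. indicator {0..T} s * f s) = 0"
    using zero unfolding stieltjes_integral_zero_def M set_integrable_def
      set_lebesgue_integral_def by simp_all
  have AE: "AE s in ?M. indicator {0..T} s * f s = 0"
    using sign
  proof
    assume "\<forall>t\<in>{0..T}. 0 \<le> f t"
    then show ?thesis
      using integral_nonneg_eq_0_iff_AE[OF int] int0 by (auto simp: indicator_def)
  next
    assume "\<forall>t\<in>{0..T}. f t \<le> 0"
    then show ?thesis
      using integral_nonneg_eq_0_iff_AE[of ?M "\<lambda>s. - (indicator {0..T} s * f s)"] int int0
      by (auto simp: indicator_def)
  qed
  have F_eq: "F u = F v" if "u \<le> v" and off: "\<And>t. u < t \<Longrightarrow> t \<le> v \<Longrightarrow> P t" 
    and null: "AE t in ?M. \<not> P t" for u v P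
  proof -
    have "{u<..v} \<in> null_sets ?M"
      by (rule AE_iff_null_sets[THEN iffD2]) (use null off in \<open>auto elim: eventually_mono\<close>)
    then have "ennreal (F v - F u) = 0"
      using emeasure_interval_measure_Ioc[OF \<open>u \<le> v\<close> F_mono F_right] by auto
    then show ?thesis using F_mono[OF \<open>u \<le> v\<close>] by (auto simp: ennreal_eq_0_iff)
  qed
  {
    assume "f 0 \<noteq> 0"
    \<comment> \<open>The measure does not charge the negative half-line, so the atom at 0 is \<open>F 0 - F (-1)\<close>.\<close>
    have "{-1<..- inverse (real (Suc n))} \<in> null_sets ?M" for n
      using emeasure_interval_measure_Ioc[OF _ F_mono F_right, of "-1" "- inverse (real (Suc n))"]
      by (auto simp: F_def null_sets_def field_simps)
    then have "AE t in ?M. \<forall>n. t \<notin> {-1<..- inverse (real (Suc n))}"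
      unfolding AE_all_countable by (intro allI AE_not_in)
    with AE have "AE t in ?M. \<not> (-1 < t \<and> t \<le> 0)"
    proof eventually_elim
      case (elim t)
      show ?case
      proof
        assume t: "-1 < t \<and> t \<le> 0"
        with elim(1) \<open>f 0 \<noteq> 0\<close> \<open>0 \<le> T\<close> have "0 < - t" by (cases "t = 0") auto
        from reals_Archimedean[OF this] obtain n where "inverse (real (Suc n)) < - t" by blast
        then show False using elim(2) t by (auto dest!: spec[of _ n])
      qed
    qed
    then have "F (-1) = F 0" by (rule F_eq[rotated 2]) auto
    then show "a 0 = 0" using \<open>0 \<le> T\<close> by (simp add: F_def)
  next
    assume uv: "0 \<le> u" "u \<le> v" "v \<le> T" and off: "\<And>t. u < t \<Longrightarrow> t \<le> v \<Longrightarrow> f t \<noteq> 0"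
    have "F u = F v"
      by (rule F_eq[where P = "\<lambda>t. indicator {0..T} t * f t \<noteq> 0"]) (use uv off AE in auto)
    then show "a u = a v" using uv by (simp add: F_def)
  }
qed

section \<open>Quasi-sure statements\<close>

lemma polar_iff_null_sets:
  assumes "\<forall>P\<in>\<P>. sets P = sets (path_space T)"
  shows "polar T \<P> N \<longleftrightarrow> N \<in> sets (path_space T) \<and> (\<forall>P\<in>\<P>. N \<in> null_sets P)"
  using assms by (auto simp: polar_def null_sets_def bot_ennreal[symmetric] SUP_bot_conv)

lemma quasi_surely_countable_all:
  assumes sets: "\<forall>P\<in>\<P>. sets P = sets (path_space T)"
    and "countable I" and Q: "\<And>i. i \<in> I \<Longrightarrow> quasi_surely T \<P> (Q i)"
  shows "quasi_surely T \<P> (\<lambda>\<omega>. \<forall>i\<in>I. Q i \<omega>)"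
proof -
  obtain N where N: "\<And>i. i \<in> I \<Longrightarrow> polar T \<P> (N i)"
    "\<And>i \<omega>. i \<in> I \<Longrightarrow> \<omega> \<in> Omega T - N i \<Longrightarrow> Q i \<omega>"
    using Q unfolding quasi_surely_def by metis
  have "polar T \<P> (\<Union>i\<in>I. N i)"
    using N(1) \<open>countable I\<close> by (auto simp: polar_iff_null_sets[OF sets] intro!: sets.countable_UN'' null_sets_UN')
  then show ?thesis
    unfolding quasi_surely_def using N(2) by (intro exI[of _ "\<Union>i\<in>I. N i"]) auto
qed

lemma quasi_surely_mono:
  assumes "quasi_surely T \<P> Q" and "\<And>\<omega>. Q \<omega> \<Longrightarrow> Q' \<omega>"
  shows "quasi_surely T \<P> Q'"
  using assms unfolding quasi_surely_def by blast

lemma quasi_surely_conj: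
  assumes sets: "\<forall>P\<in>\<P>. sets P = sets (path_space T)"
    and "quasi_surely T \<P> Q" "quasi_surely T \<P> Q'"
  shows "quasi_surely T \<P> (\<lambda>\<omega>. Q \<omega> \<and> Q' \<omega>)"
  using quasi_surely_countable_all[of \<P> T "UNIV :: bool set" "\<lambda>b. if b then Q else Q'"] assms
  by (auto elim!: quasi_surely_mono simp: all_bool_eq split: if_splits)

section \<open>Continuity of paths\<close>

lemma S_G0_continuous:
  assumes "\<eta> \<in> S_G0 T" and \<omega>: "\<omega> \<in> Omega T"
  shows "continuous_on {0..T} (\<lambda>t. \<eta> t \<omega>)"
proof -
  obtain ts h where h: "h \<in> C_bLip (length ts + 1)"
    and \<eta>: "\<And>t \<omega>. t \<in> {0..T} \<Longrightarrow> \<omega> \<in> Omega T \<Longrightarrow> \<eta> t \<omega> = h (t # map (\<lambda>s. B (min s t) \<omega>) ts)"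
    using assms(1) unfolding S_G0_def by blast
  define w where "w = (\<lambda>t. t # map (\<lambda>s. B (min s t) \<omega>) ts)"
  obtain C where C: "\<bar>h xs - h ys\<bar> \<le> C * ldist xs ys"
    if "length xs = length ts + 1" "length ys = length ts + 1" for xs ys
    using h unfolding C_bLip_def by blast
  have "((\<lambda>t. h (w t)) \<longlongrightarrow> h (w u)) (at u)" for u
  proof -
    have "((\<lambda>t. w t ! i) \<longlongrightarrow> w u ! i) (at u)" if "i < length ts + 1" for i
    proof (cases i)
      case (Suc j)
      have "isCont (\<lambda>t. B (min (ts ! j) t) \<omega>) u"
        by (rule isCont_o2[where g = "apply_bcontfun \<omega>"])
           (auto intro!: continuous_intros continuous_on_interior[of UNIV])
      then show ?thesis using Suc that by (simp add: w_def isCont_def)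
    qed (simp add: w_def)
    then have "((\<lambda>t. sqrt (\<Sum>i<length ts + 1. (w t ! i - w u ! i)\<^sup>2)) \<longlongrightarrow>
        sqrt (\<Sum>i<length ts + 1. (w u ! i - w u ! i)\<^sup>2)) (at u)"
      by (intro tendsto_intros) simp
    moreover have "ldist (w t) (w u) = sqrt (\<Sum>i<length ts + 1. (w t ! i - w u ! i)\<^sup>2)" for t
      by (simp add: ldist_def L2_set_def w_def)
    ultimately have "((\<lambda>t. C * ldist (w t) (w u)) \<longlongrightarrow> 0) (at u)"
      by (simp add: tendsto_mult_right_zero)
    then have "((\<lambda>t. h (w t) - h (w u)) \<longlongrightarrow> 0) (at u)"
      by (rule Lim_null_comparison[rotated]) (auto intro!: always_eventually C simp: w_def)
    then show ?thesis by (rule LIM_zero_cancel)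
  qed
  then have "continuous_on {0..T} (\<lambda>t. h (w t))"
    by (auto intro!: continuous_at_imp_continuous_on simp: isCont_def)
  then show ?thesis by (rule continuous_on_eq) (use \<eta> \<omega> in \<open>simp add: w_def\<close>)
qed

text \<open>
  Along a subsequence the approximations from \<open>S_G0\<close> have errors that admit Borel majorants with
  summable upper expectations.  The sum of the majorants is finite off a polar set, and there the
  approximations converge uniformly in time.
\<close>

lemma S_G_continuous_paths:
  assumes sets: "\<forall>P\<in>\<P>. sets P = sets (path_space T)"
    and \<eta>: "\<eta> \<in> S_G T \<P> p" and "0 < p"
  shows "quasi_surely T \<P> (\<lambda>\<omega>. continuous_on {0..T} (\<lambda>t. \<eta> t \<omega>))"
proof -
  obtain H where H: "\<And>n. H n \<in> S_G0 T"
    and lim: "(\<lambda>n. upper_expectation T \<P>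
        (\<lambda>\<omega>. SUP t\<in>{0..T}. ennreal (\<bar>H n t \<omega> - \<eta> t \<omega>\<bar> powr p))) \<longlonglongrightarrow> 0"
    using \<eta> unfolding S_G_def by blast
  \<comment> \<open>\<open>majorant k n g\<close>: \<open>g\<close> witnesses that the \<open>n\<close>-th error has upper expectation below \<open>2\<^sup>-\<^sup>k\<close>.\<close>
  define majorant where "majorant = (\<lambda>k n g. g \<in> borel_measurable (path_space T) \<and>
      (\<forall>\<omega>\<in>Omega T. (SUP t\<in>{0..T}. ennreal (\<bar>H n t \<omega> - \<eta> t \<omega>\<bar> powr p)) \<le> g \<omega>) \<and>
      (SUP P\<in>\<P>. \<integral>\<^sup>+\<omega>. g \<omega> \<partial>P) < ennreal ((1/2) ^ k))"
  have "\<exists>n g. majorant k n g" for k :: nat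
  proof -
    have "\<forall>\<^sub>F n in sequentially. upper_expectation T \<P>
        (\<lambda>\<omega>. SUP t\<in>{0..T}. ennreal (\<bar>H n t \<omega> - \<eta> t \<omega>\<bar> powr p)) < ennreal ((1/2) ^ k)"
      by (rule order_tendstoD(2)[OF lim]) simp
    then obtain n where "upper_expectation T \<P>
        (\<lambda>\<omega>. SUP t\<in>{0..T}. ennreal (\<bar>H n t \<omega> - \<eta> t \<omega>\<bar> powr p)) < ennreal ((1/2) ^ k)"
      using eventually_happens'[OF sequentially_bot] by blast
    then show ?thesis
      unfolding upper_expectation_def INF_less_iff majorant_def by blast
  qed
  then obtain n g where "\<And>k. majorant k (n k) (g k)" by metis
  then have g: "\<And>k. g k \<in> borel_measurable (path_space T)"
    and major: "\<And>k \<omega>. \<omega> \<in> Omega T \<Longrightarrow>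
        (SUP t\<in>{0..T}. ennreal (\<bar>H (n k) t \<omega> - \<eta> t \<omega>\<bar> powr p)) \<le> g k \<omega>"
    and small: "\<And>k. (SUP P\<in>\<P>. \<integral>\<^sup>+\<omega>. g k \<omega> \<partial>P) < ennreal ((1/2) ^ k)"
    unfolding majorant_def by blast+
  define N where "N = {\<omega> \<in> space (path_space T). (\<Sum>k. g k \<omega>) = \<infinity>}"
  have "polar T \<P> N"
    unfolding polar_iff_null_sets[OF sets]
  proof (intro conjI ballI)
    show N: "N \<in> sets (path_space T)" unfolding N_def using g by measurable
    fix P assume P: "P \<in> \<P>"
    note [measurable_cong] = bspec[OF sets P]
    have [measurable]: "g k \<in> borel_measurable P" for k
      using g measurable_cong_sets[OF bspec[OF sets P] refl] by blast
    have "(\<integral>\<^sup>+\<omega>. (\<Sum>k. g k \<omega>) \<partial>P) = (\<Sum>k. \<integral>\<^sup>+\<omega>. g k \<omega> \<partial>P)"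
      by (rule nn_integral_suminf) simp
    also have "\<dots> \<le> (\<Sum>k. ennreal ((1/2) ^ k))"
      by (intro suminf_le order_trans[OF SUP_upper[OF P] less_imp_le[OF small]]) auto
    also have "\<dots> = ennreal (\<Sum>k. (1/2) ^ k)"
      by (rule suminf_ennreal2) (auto intro: summable_geometric)
    also have "\<dots> < \<infinity>" by simp
    finally have "AE \<omega> in P. (\<Sum>k. g k \<omega>) \<noteq> \<infinity>"
      by (intro nn_integral_PInf_AE) auto
    then show "N \<in> null_sets P"
      using N bspec[OF sets P] sets_eq_imp_space_eq[OF bspec[OF sets P]]
      by (intro AE_iff_null_sets[THEN iffD2]) (auto simp: N_def elim: eventually_mono)
  qed
  moreover have "continuous_on {0..T} (\<lambda>t. \<eta> t \<omega>)" if \<omega>: "\<omega> \<in> Omega T - N" for \<omega>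
  proof -
    define a where "a = (\<lambda>k. enn2real (g k \<omega>))"
    have fin: "(\<Sum>k. g k \<omega>) \<noteq> \<infinity>"
      using \<omega> by (auto simp: N_def path_space_def space_restrict_space)
    then have ga: "g k \<omega> = ennreal (a k)" for k
      unfolding a_def using ennreal_suminf_lessD[of "\<lambda>k. g k \<omega>" \<infinity>]
      by (simp add: less_top)
    have a_nonneg: "0 \<le> a k" for k by (simp add: a_def)
    have "summable a"
      by (rule summable_suminf_not_top) (use fin in \<open>simp_all add: ga a_nonneg\<close>)
    then have a0: "a \<longlonglongrightarrow> 0" by (rule summable_LIMSEQ_zero)
    have bound: "\<bar>H (n k) t \<omega> - \<eta> t \<omega>\<bar> powr p \<le> a k" if "t \<in> {0..T}" for k t
    proof -
      have "ennreal (\<bar>H (n k) t \<omega> - \<eta> t \<omega>\<bar> powr p)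
          \<le> (SUP t\<in>{0..T}. ennreal (\<bar>H (n k) t \<omega> - \<eta> t \<omega>\<bar> powr p))"
        using that by (rule SUP_upper)
      also have "\<dots> \<le> g k \<omega>" using major \<omega> by blast
      finally show ?thesis by (simp add: ga ennreal_le_iff a_nonneg)
    qed
    have "uniform_limit {0..T} (\<lambda>k t. H (n k) t \<omega>) (\<lambda>t. \<eta> t \<omega>) sequentially"
    proof (rule uniform_limitI)
      fix e :: real assume "0 < e"
      then have "\<forall>\<^sub>F k in sequentially. a k < e powr p"
        by (intro order_tendstoD(2)[OF a0]) simp
      then show "\<forall>\<^sub>F k in sequentially. \<forall>t\<in>{0..T}. dist (H (n k) t \<omega>) (\<eta> t \<omega>) < e"
      proof eventually_elim
        case (elim k)
        show ?case
        proof (intro ballI, rule ccontr)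
          fix t assume t: "t \<in> {0..T}" and "\<not> dist (H (n k) t \<omega>) (\<eta> t \<omega>) < e"
          then have "e powr p \<le> \<bar>H (n k) t \<omega> - \<eta> t \<omega>\<bar> powr p"
            using \<open>0 < e\<close> \<open>0 < p\<close> by (intro powr_mono2) (auto simp: dist_real_def)
          then show False using bound[OF t, of k] elim by linarith
        qed
      qed
    qed
    then show ?thesis
      by (rule uniform_limit_theorem[rotated])
         (use \<omega> H in \<open>auto intro!: always_eventually S_G0_continuous\<close>)
  qed
  ultimately show ?thesis unfolding quasi_surely_def by blast
qed

text \<open>
  By monotonicity, \<open>q < z t\<close> is the condition \<open>f t q < 0\<close>, which is open in \<open>t\<close>.  Rational levels
  \<open>q\<close> suffice; since the exceptional set for the continuity of a constraint depends on the level,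
  only countably many levels can be used at once.
\<close>

lemma continuous_on_zero:
  fixes f :: "real \<Rightarrow> real \<Rightarrow> real"
  assumes cont: "\<And>q. q \<in> \<rat> \<Longrightarrow> continuous_on S (\<lambda>t. f t q)"
    and mono: "\<And>t. t \<in> S \<Longrightarrow> strict_mono (f t)"
    and zero: "\<And>t. t \<in> S \<Longrightarrow> f t (z t) = 0"
  shows "continuous_on S z"
  unfolding continuous_on_def
proof (intro ballI order_tendstoI)
  fix t c assume t: "t \<in> S" and "c < z t"
  then obtain q where q: "q \<in> \<rat>" "c < q" "q < z t" using Rats_dense_in_real by blast
  then have "f t q < 0" using strict_monoD[OF mono[OF t]] zero[OF t] by metis
  then have "\<forall>\<^sub>F s in at t within S. f s q < 0"
    using cont[OF q(1)] t by (auto simp: continuous_on_def intro: order_tendstoD(2))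
  moreover have "\<forall>\<^sub>F s in at t within S. s \<in> S" by (simp add: eventually_at_filter)
  ultimately show "\<forall>\<^sub>F s in at t within S. c < z s"
  proof eventually_elim
    case (elim s)
    then have "q < z s" using zero[of s] strict_mono_less[OF mono] by metis
    then show ?case using q by simp
  qed
next
  fix t c assume t: "t \<in> S" and "z t < c"
  then obtain q where q: "q \<in> \<rat>" "z t < q" "q < c" using Rats_dense_in_real by blast
  then have "0 < f t q" using strict_monoD[OF mono[OF t]] zero[OF t] by metis
  then have "\<forall>\<^sub>F s in at t within S. 0 < f s q"
    using cont[OF q(1)] t by (auto simp: continuous_on_def intro: order_tendstoD(1))
  moreover have "\<forall>\<^sub>F s in at t within S. s \<in> S" by (simp add: eventually_at_filter)
  ultimately show "\<forall>\<^sub>F s in at t within S. z s < c"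
  proof eventually_elim
    case (elim s)
    then have "z s < q" using zero[of s] strict_mono_less[OF mono] by metis
    then show ?case using q by simp
  qed
qed

section \<open>Reflected problems path by path\<close>

lemma represents_sets:
  assumes "represents T \<P> E" "P \<in> \<P>"
  shows "sets P = sets (path_space T)"
proof -
  have "\<P> \<subseteq> topspace (weak_topology T)"
    using assms(1) by (simp add: represents_def compactin_subset_topspace)
  also have "\<dots> \<subseteq> path_probs T"
    by (auto simp: weak_topology_def topology_generated_by_topspace)
  finally show ?thesis using assms(2) by (auto simp: path_probs_def)
qed

lemma inverse_at_0_zero:
  assumes "strict_mono (f t \<omega>)" "\<exists>x. f t \<omega> x = 0"
  shows "f t \<omega> (inverse_at_0 f t \<omega>) = 0"
  unfolding inverse_at_0_def
  by (rule theI') (use assms in \<open>metis strict_mono_eq\<close>)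

lemma constraint_sign:
  assumes "strict_mono (f t \<omega>)" "f t \<omega> (inverse_at_0 f t \<omega>) = 0"
  shows "f t \<omega> x \<le> 0 \<longleftrightarrow> x \<le> inverse_at_0 f t \<omega>" "0 \<le> f t \<omega> x \<longleftrightarrow> inverse_at_0 f t \<omega> \<le> x"
    "f t \<omega> x = 0 \<longleftrightarrow> x = inverse_at_0 f t \<omega>"
  using strict_mono_less_eq[OF assms(1)] strict_mono_eq[OF assms(1)] assms(2) by metis+

lemma admissible_barriers:
  assumes sets: "\<forall>P\<in>\<P>. sets P = sets (path_space T)" and adm: "admissible T \<P> p l r"
  shows "quasi_surely T \<P> (\<lambda>\<omega>. continuous_on {0..T} (\<lambda>t. inverse_at_0 l t \<omega>) \<and>
      continuous_on {0..T} (\<lambda>t. inverse_at_0 r t \<omega>) \<and>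
      (\<forall>t\<in>{0..T}. strict_mono (l t \<omega>) \<and> strict_mono (r t \<omega>) \<and>
        l t \<omega> (inverse_at_0 l t \<omega>) = 0 \<and> r t \<omega> (inverse_at_0 r t \<omega>) = 0 \<and>
        inverse_at_0 r t \<omega> < inverse_at_0 l t \<omega>))"
proof -
  have "quasi_surely T \<P> (\<lambda>\<omega>. \<forall>q\<in>\<rat>. continuous_on {0..T} (\<lambda>t. r t \<omega> q) \<and>
      continuous_on {0..T} (\<lambda>t. l t \<omega> q))"
    by (rule quasi_surely_countable_all[OF sets countable_rat]) (use adm in \<open>simp add: admissible_def\<close>)
  moreover have "quasi_surely T \<P> (\<lambda>\<omega>. \<forall>t\<in>{0..T}. strict_mono (r t \<omega>) \<and> strict_mono (l t \<omega>) \<and>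
      (\<forall>x. l t \<omega> x < r t \<omega> x))"
    using adm unfolding admissible_def by blast
  moreover have "quasi_surely T \<P> (\<lambda>\<omega>. \<forall>t\<in>{0..T}. (\<exists>x. r t \<omega> x = 0) \<and> (\<exists>x. l t \<omega> x = 0))"
    using adm unfolding admissible_def by blast
  ultimately have "quasi_surely T \<P> (\<lambda>\<omega>.
      (\<forall>q\<in>\<rat>. continuous_on {0..T} (\<lambda>t. r t \<omega> q) \<and> continuous_on {0..T} (\<lambda>t. l t \<omega> q)) \<and>
      (\<forall>t\<in>{0..T}. strict_mono (r t \<omega>) \<and> strict_mono (l t \<omega>) \<and> (\<forall>x. l t \<omega> x < r t \<omega> x)) \<and>
      (\<forall>t\<in>{0..T}. (\<exists>x. r t \<omega> x = 0) \<and> (\<exists>x. l t \<omega> x = 0)))"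
    by (intro quasi_surely_conj[OF sets])
  then show ?thesis
  proof (rule quasi_surely_mono, elim conjE)
    fix \<omega>
    assume cont: "\<forall>q\<in>\<rat>. continuous_on {0..T} (\<lambda>t. r t \<omega> q) \<and> continuous_on {0..T} (\<lambda>t. l t \<omega> q)"
      and mono: "\<forall>t\<in>{0..T}. strict_mono (r t \<omega>) \<and> strict_mono (l t \<omega>) \<and> (\<forall>x. l t \<omega> x < r t \<omega> x)"
      and ex: "\<forall>t\<in>{0..T}. (\<exists>x. r t \<omega> x = 0) \<and> (\<exists>x. l t \<omega> x = 0)"
    have zero: "l t \<omega> (inverse_at_0 l t \<omega>) = 0" "r t \<omega> (inverse_at_0 r t \<omega>) = 0"
      if "t \<in> {0..T}" for t
      using mono ex that by (blast intro: inverse_at_0_zero)+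
    have "inverse_at_0 r t \<omega> < inverse_at_0 l t \<omega>" if t: "t \<in> {0..T}" for t
    proof -
      have "l t \<omega> (inverse_at_0 r t \<omega>) < r t \<omega> (inverse_at_0 r t \<omega>)" using mono t by blast
      then have "l t \<omega> (inverse_at_0 r t \<omega>) < l t \<omega> (inverse_at_0 l t \<omega>)" using zero[OF t] by simp
      then show ?thesis using mono t strict_mono_less by blast
    qed
    moreover have "continuous_on {0..T} (\<lambda>t. inverse_at_0 l t \<omega>)"
      by (rule continuous_on_zero[where f = "\<lambda>t. l t \<omega>"]) (use cont mono zero in blast)+
    moreover have "continuous_on {0..T} (\<lambda>t. inverse_at_0 r t \<omega>)"
      by (rule continuous_on_zero[where f = "\<lambda>t. r t \<omega>"]) (use cont mono zero in blast)+
    ultimately show "continuous_on {0..T} (\<lambda>t. inverse_at_0 l t \<omega>) \<and>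
      continuous_on {0..T} (\<lambda>t. inverse_at_0 r t \<omega>) \<and>
      (\<forall>t\<in>{0..T}. strict_mono (l t \<omega>) \<and> strict_mono (r t \<omega>) \<and>
        l t \<omega> (inverse_at_0 l t \<omega>) = 0 \<and> r t \<omega> (inverse_at_0 r t \<omega>) = 0 \<and>
        inverse_at_0 r t \<omega> < inverse_at_0 l t \<omega>)"
      using mono zero by simp
  qed
qed

lemma constraining_processes_reflected_path:
  assumes sets: "\<forall>P\<in>\<P>. sets P = sets (path_space T)"
    and "0 \<le> T" "0 < p" and adm: "admissible T \<P> p l r" and S: "S \<in> S_G T \<P> p"
    and con: "constraining_processes T \<P> p l r S Al Ar"
  shows "quasi_surely T \<P> (\<lambda>\<omega>. reflected_path T (\<lambda>t. inverse_at_0 l t \<omega>)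
      (\<lambda>t. inverse_at_0 r t \<omega>) (\<lambda>t. S t \<omega>) (\<lambda>t. Al t \<omega>) (\<lambda>t. Ar t \<omega>))"
proof -
  obtain X A where sol: "reflected_solution T \<P> p l r S X A Al Ar"
    using con unfolding constraining_processes_def by blast
  note bar = admissible_barriers[OF sets adm]
  note cont = S_G_continuous_paths[OF sets S \<open>0 < p\<close>]
  have Al: "quasi_surely T \<P> (\<lambda>\<omega>. continuous_on {0..T} (\<lambda>t. Al t \<omega>) \<and> mono_on {0..T} (\<lambda>t. Al t \<omega>))"
    and Ar: "quasi_surely T \<P> (\<lambda>\<omega>. continuous_on {0..T} (\<lambda>t. Ar t \<omega>) \<and> mono_on {0..T} (\<lambda>t. Ar t \<omega>))"
    and X: "quasi_surely T \<P> (\<lambda>\<omega>. \<forall>t\<in>{0..T}. X t \<omega> = S t \<omega> + A t \<omega>)"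
    and lr: "quasi_surely T \<P> (\<lambda>\<omega>. \<forall>t\<in>{0..T}. l t \<omega> (X t \<omega>) \<le> 0 \<and> 0 \<le> r t \<omega> (X t \<omega>))"
    and A: "quasi_surely T \<P> (\<lambda>\<omega>. \<forall>t\<in>{0..T}. A t \<omega> = Ar t \<omega> - Al t \<omega>)"
    and A0: "quasi_surely T \<P> (\<lambda>\<omega>. 0 \<le> Ar 0 \<omega> \<and> 0 \<le> Al 0 \<omega>)"
    and int: "quasi_surely T \<P> (\<lambda>\<omega>.
       stieltjes_integral_zero T (\<lambda>s. l s \<omega> (X s \<omega>)) (\<lambda>s. Al s \<omega>) \<and>
       stieltjes_integral_zero T (\<lambda>s. r s \<omega> (X s \<omega>)) (\<lambda>s. Ar s \<omega>))"
    using sol by (simp_all add: reflected_solution_def M_I_def)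
  show ?thesis
    using quasi_surely_conj[OF sets bar quasi_surely_conj[OF sets cont quasi_surely_conj[OF sets Al
      quasi_surely_conj[OF sets Ar quasi_surely_conj[OF sets X quasi_surely_conj[OF sets lr
      quasi_surely_conj[OF sets A quasi_surely_conj[OF sets A0 int]]]]]]]]
  proof (rule quasi_surely_mono, elim conjE)
    fix \<omega>
    let ?L = "\<lambda>t. inverse_at_0 l t \<omega>" and ?R = "\<lambda>t. inverse_at_0 r t \<omega>"
      and ?x = "\<lambda>t. S t \<omega> + Ar t \<omega> - Al t \<omega>"
    assume bar: "\<forall>t\<in>{0..T}. strict_mono (l t \<omega>) \<and> strict_mono (r t \<omega>) \<and>
        l t \<omega> (?L t) = 0 \<and> r t \<omega> (?R t) = 0 \<and> ?R t < ?L t"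
      and cont: "continuous_on {0..T} ?L" "continuous_on {0..T} ?R"
        "continuous_on {0..T} (\<lambda>t. S t \<omega>)" "continuous_on {0..T} (\<lambda>t. Al t \<omega>)"
        "continuous_on {0..T} (\<lambda>t. Ar t \<omega>)"
      and mono: "mono_on {0..T} (\<lambda>t. Al t \<omega>)" "mono_on {0..T} (\<lambda>t. Ar t \<omega>)"
      and X: "\<forall>t\<in>{0..T}. X t \<omega> = S t \<omega> + A t \<omega>"
      and lr: "\<forall>t\<in>{0..T}. l t \<omega> (X t \<omega>) \<le> 0 \<and> 0 \<le> r t \<omega> (X t \<omega>)"
      and A: "\<forall>t\<in>{0..T}. A t \<omega> = Ar t \<omega> - Al t \<omega>"
      and A0: "0 \<le> Ar 0 \<omega>" "0 \<le> Al 0 \<omega>"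
      and int: "stieltjes_integral_zero T (\<lambda>s. l s \<omega> (X s \<omega>)) (\<lambda>s. Al s \<omega>)"
        "stieltjes_integral_zero T (\<lambda>s. r s \<omega> (X s \<omega>)) (\<lambda>s. Ar s \<omega>)"
    have sign: "?R t \<le> ?x t" "?x t \<le> ?L t"
      "l t \<omega> (X t \<omega>) = 0 \<longleftrightarrow> ?x t = ?L t" "r t \<omega> (X t \<omega>) = 0 \<longleftrightarrow> ?x t = ?R t"
      if t: "t \<in> {0..T}" for t
    proof -
      have x: "X t \<omega> = ?x t" using X A t by simp
      have f: "strict_mono (l t \<omega>)" "l t \<omega> (?L t) = 0" "strict_mono (r t \<omega>)" "r t \<omega> (?R t) = 0"
        "l t \<omega> (X t \<omega>) \<le> 0" "0 \<le> r t \<omega> (X t \<omega>)"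
        using bar lr t by blast+
      show "?R t \<le> ?x t" "?x t \<le> ?L t"
        "l t \<omega> (X t \<omega>) = 0 \<longleftrightarrow> ?x t = ?L t" "r t \<omega> (X t \<omega>) = 0 \<longleftrightarrow> ?x t = ?R t"
        using constraint_sign[of l t \<omega> "X t \<omega>", OF f(1,2)]
          constraint_sign[of r t \<omega> "X t \<omega>", OF f(3,4)] f(5,6)
        unfolding x by blast+
    qed
    have neg: "(\<forall>t\<in>{0..T}. 0 \<le> l t \<omega> (X t \<omega>)) \<or> (\<forall>t\<in>{0..T}. l t \<omega> (X t \<omega>) \<le> 0)"
      and pos: "(\<forall>t\<in>{0..T}. 0 \<le> r t \<omega> (X t \<omega>)) \<or> (\<forall>t\<in>{0..T}. r t \<omega> (X t \<omega>) \<le> 0)"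
      using lr by blast+
    note flat_l = stieltjes_integral_zero_flat[OF int(1) neg cont(4) mono(1) A0(2) \<open>0 \<le> T\<close>]
    note flat_r = stieltjes_integral_zero_flat[OF int(2) pos cont(5) mono(2) A0(1) \<open>0 \<le> T\<close>]
    show "reflected_path T ?L ?R (\<lambda>t. S t \<omega>) (\<lambda>t. Al t \<omega>) (\<lambda>t. Ar t \<omega>)"
    proof
      have "0 \<in> {0..T}" using \<open>0 \<le> T\<close> by simp
      then show "Al 0 \<omega> = 0" if "?x 0 < ?L 0"
        using that sign(3) by (intro flat_l(1)) simp
      show "Ar 0 \<omega> = 0" if "?R 0 < ?x 0"
        using that sign(4) \<open>0 \<in> {0..T}\<close> by (intro flat_r(1)) simp
      show "Al u \<omega> = Al v \<omega>" if uv: "0 \<le> u" "u \<le> v" "v \<le> T"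
        and off: "\<And>t. u < t \<Longrightarrow> t \<le> v \<Longrightarrow> ?x t < ?L t" for u v
      proof (rule flat_l(2)[OF uv])
        fix t assume t: "u < t" "t \<le> v"
        then have "t \<in> {0..T}" using uv by simp
        then show "l t \<omega> (X t \<omega>) \<noteq> 0" using sign(3) off[OF t] by simp
      qed
      show "Ar u \<omega> = Ar v \<omega>" if uv: "0 \<le> u" "u \<le> v" "v \<le> T"
        and off: "\<And>t. u < t \<Longrightarrow> t \<le> v \<Longrightarrow> ?R t < ?x t" for u v
      proof (rule flat_r(2)[OF uv])
        fix t assume t: "u < t" "t \<le> v"
        then have "t \<in> {0..T}" using uv by simp
        then show "r t \<omega> (X t \<omega>) \<noteq> 0" using sign(4) off[OF t] by simp
      qed
      show "?R t < ?L t" if "t \<in> {0..T}" for t using bar that by blast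
    qed (fact cont mono A0 sign(1,2))+
  qed
qed

theorem proposition3p8:
  fixes T sl su p :: real
    and E :: "(path \<Rightarrow> real) \<Rightarrow> real"
    and \<P> :: "path measure set"
    and l r l' r' :: constraint
    and S Al Ar Al' Ar' :: process
  assumes "0 < T"
    and "0 \<le> sl\<^sup>2" and "sl\<^sup>2 < su\<^sup>2"
    and "G_expectation T sl su E"
    and "represents T \<P> E"
    and "2 \<le> p"
    and "admissible T \<P> p l r"
    and "admissible T \<P> p l' r'"
    and "S \<in> S_G T \<P> p"
    and "constraining_processes T \<P> p l r S Al Ar"
    and "constraining_processes T \<P> p l' r' S Al' Ar'"
    and "quasi_surely T \<P> (\<lambda>\<omega>. \<forall>t\<in>{0..T}. \<forall>x. r' t \<omega> x \<le> r t \<omega> x \<and> l t \<omega> x \<le> l' t \<omega> x)"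
  shows "quasi_surely T \<P> (\<lambda>\<omega>. \<forall>t\<in>{0..T}. Al t \<omega> \<le> Al' t \<omega> \<and> Ar t \<omega> \<le> Ar' t \<omega>)"
proof -
  have sets: "\<forall>P\<in>\<P>. sets P = sets (path_space T)"
    using represents_sets[OF \<open>represents T \<P> E\<close>] by blast
  have "0 \<le> T" "0 < p" using \<open>0 < T\<close> \<open>2 \<le> p\<close> by simp_all
  note path = constraining_processes_reflected_path[OF sets \<open>0 \<le> T\<close> \<open>0 < p\<close> _ \<open>S \<in> S_G T \<P> p\<close>]
  note bar = admissible_barriers[OF sets \<open>admissible T \<P> p l r\<close>]
    admissible_barriers[OF sets \<open>admissible T \<P> p l' r'\<close>]
  show ?thesis
    using quasi_surely_conj[OF sets path[OF assms(7,10)] quasi_surely_conj[OF sets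
      path[OF assms(8,11)] quasi_surely_conj[OF sets bar(1) quasi_surely_conj[OF sets
      bar(2) assms(12)]]]]
  proof (rule quasi_surely_mono, elim conjE, intro ballI)
    fix \<omega> t
    let ?L = "\<lambda>t. inverse_at_0 l t \<omega>" and ?R = "\<lambda>t. inverse_at_0 r t \<omega>"
      and ?L' = "\<lambda>t. inverse_at_0 l' t \<omega>" and ?R' = "\<lambda>t. inverse_at_0 r' t \<omega>"
    assume path: "reflected_path T ?L ?R (\<lambda>t. S t \<omega>) (\<lambda>t. Al t \<omega>) (\<lambda>t. Ar t \<omega>)"
        "reflected_path T ?L' ?R' (\<lambda>t. S t \<omega>) (\<lambda>t. Al' t \<omega>) (\<lambda>t. Ar' t \<omega>)"
      and bar: "\<forall>t\<in>{0..T}. strict_mono (l t \<omega>) \<and> strict_mono (r t \<omega>) \<and>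
        l t \<omega> (?L t) = 0 \<and> r t \<omega> (?R t) = 0 \<and> ?R t < ?L t"
        "\<forall>t\<in>{0..T}. strict_mono (l' t \<omega>) \<and> strict_mono (r' t \<omega>) \<and>
        l' t \<omega> (?L' t) = 0 \<and> r' t \<omega> (?R' t) = 0 \<and> ?R' t < ?L' t"
      and le: "\<forall>t\<in>{0..T}. \<forall>x. r' t \<omega> x \<le> r t \<omega> x \<and> l t \<omega> x \<le> l' t \<omega> x"
      and t: "t \<in> {0..T}"
    have "?R q \<le> ?R' q" if "q \<in> {0..T}" for q
      using constraint_sign(2)[of r q \<omega> "?R' q"] bar le that by metis
    moreover have "?L' q \<le> ?L q" if "q \<in> {0..T}" for q
      using constraint_sign(1)[of l q \<omega> "?L' q"] bar le that by metis
    ultimately show "Al t \<omega> \<le> Al' t \<omega> \<and> Ar t \<omega> \<le> Ar' t \<omega>"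
      by (rule reflected_path_comparison[OF path]) (use t in auto)
  qed
qed

end
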